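(* Let $0<C<1$ and let $C_1,C_2\in(0,2]$. Consider the adaptive dynamics of the alternating memory-1 game with payoff vector $(f_1,f_2,f_3,f_4)=(1-C,-C,1,0)$, restricted to the torus $(p_1-1)^2+p_3^2=C_1$, $(p_2-1)^2+p_4^2=C_2$, parametrised by angles $\phi,\psi\in[0,2\pi]$ via $$p_1=1+\sqrt{C_1}\sin\phi,\quad p_2=1+\sqrt{C_2}\sin\psi,\quad p_3=\sqrt{C_1}\cos\phi,\quad p_4=\sqrt{C_2}\cos\psi.$$ Then there are no more than four equilibria of the dynamics in the set of $(\phi,\psi)$ corresponding to points $\mathbf p\in(0,1)^4$.
   Context: Write $\mathbf p=(p_1,p_2,p_3,p_4)=(p_{CC},p_{CD},p_{DC},p_{DD})$ and similarly $\mathbf q$. The transition matrix of the alternating memory-1 game is $$\mathbf M_1(\mathbf p,\mathbf q)=\begin{pmatrix} p_1q_1&p_1(1-q_1)&(1-p_1)q_2&(1-p_1)(1-q_2)\\ p_2q_3&p_2(1-q_3)&(1-p_2)q_4&(1-p_2)(1-q_4)\\ p_3q_1&p_3(1-q_1)&(1-p_3)q_2&(1-p_3)(1-q_2)\\ p_4q_3&p_4(1-q_3)&(1-p_4)q_4&(1-p_4)(1-q_4)\end{pmatrix}.$$ The payoff function is $A(\mathbf p,\mathbf q)=\det\mathbf M^1/\det\mathbf M^2$, where $\mathbf M^1$ is $\mathbf M_1(\mathbf p,\mathbf q)-I$ with its last column replaced by $(f_1,f_2,f_3,f_4)^T$ and $\mathbf M^2$ is $\mathbf M_1(\mathbf p,\mathbf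 q)-I$ with its last column replaced by $(1,1,1,1)^T$. The adaptive dynamics is the system $\dot p_i=\left.\frac{\partial A(\mathbf p,\mathbf q)}{\partial p_i}\right|_{\mathbf q=\mathbf p}$, $i=1,\ldots,4$. It is defined on $(0,1)^4$, and the functions $(p_1-1)^2+p_3^2$ and $(p_2-1)^2+p_4^2$ are constant along its solutions, so it restricts to their common level sets. An equilibrium is a point where all $\dot p_i$ vanish. *)

theory Defs
  imports "HOL-Analysis.Analysis"
begin

text \<open>
  The index type \<^typ>\<open>4\<close> enumerates the outcomes CC, CD, DC, DD as 1, 2, 3, 4
  (in \<^typ>\<open>4\<close>, the numeral 4 is the same element as 0).
\<close>

definition transition_matrix :: "real ^ 4 \<Rightarrow> real ^ 4 \<Rightarrow> real ^ 4 ^ 4" where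
  "transition_matrix p q =
    vector [
      vector [p$1 * q$1, p$1 * (1 - q$1), (1 - p$1) * q$2, (1 - p$1) * (1 - q$2)],
      vector [p$2 * q$3, p$2 * (1 - q$3), (1 - p$2) * q$4, (1 - p$2) * (1 - q$4)],
      vector [p$3 * q$1, p$3 * (1 - q$1), (1 - p$3) * q$2, (1 - p$3) * (1 - q$2)],
      vector [p$4 * q$3, p$4 * (1 - q$3), (1 - p$4) * q$4, (1 - p$4) * (1 - q$4)]]"

definition replace_last_column :: "real ^ 4 ^ 4 \<Rightarrow> real ^ 4 \<Rightarrow> real ^ 4 ^ 4" where
  "replace_last_column M v = (\<chi> i j. if j = 4 then v $ i else M $ i $ j)"

text \<open>
  The denominator vanishes for some \<^term>\<open>p\<close>, \<^term>\<open>q\<close> on the boundary of the unit cube,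
  where the quotient is 0 by convention; only the open cube is of interest.
\<close>

definition payoff :: "real ^ 4 \<Rightarrow> real ^ 4 \<Rightarrow> real ^ 4 \<Rightarrow> real" where
  "payoff f p q =
    det (replace_last_column (transition_matrix p q - mat 1) f) /
    det (replace_last_column (transition_matrix p q - mat 1) (vector [1, 1, 1, 1]))"

text \<open>
  Component \<^term>\<open>i\<close> is the partial derivative in the \<^term>\<open>i\<close>-th coordinate of the
  first argument of the payoff; the second argument is held fixed at \<^term>\<open>p\<close>
  while differentiating.
\<close>

definition adaptive_dynamics :: "real ^ 4 \<Rightarrow> real ^ 4 \<Rightarrow> real ^ 4" where
  "adaptive_dynamics f p =
    (\<chi> i. deriv (\<lambda>t. payoff f (\<chi> j. if j = i then t else p $ j) p) (p $ i))"

definition open_cube :: "(real ^ 4) set" where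
  "open_cube = {p. \<forall>i. 0 < p $ i \<and> p $ i < 1}"

definition is_equilibrium :: "real ^ 4 \<Rightarrow> real ^ 4 \<Rightarrow> bool" where
  "is_equilibrium f p \<longleftrightarrow> (\<forall>i. adaptive_dynamics f p $ i = 0)"

definition donation_payoffs :: "real \<Rightarrow> real ^ 4" where
  "donation_payoffs C = vector [1 - C, - C, 1, 0]"

definition torus_point :: "real \<Rightarrow> real \<Rightarrow> real \<Rightarrow> real \<Rightarrow> real ^ 4" where
  "torus_point C1 C2 \<phi> \<psi> =
    vector [1 + sqrt C1 * sin \<phi>, 1 + sqrt C2 * sin \<psi>, sqrt C1 * cos \<phi>, sqrt C2 * cos \<psi>]"

end

theory Submission
  imports Defs
begin

text \<open>
  In the interior of the cube, each component of the adaptive dynamics is a positive multiple of the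
  gain from cooperating rather than defecting after a given move of the co-player, so at an
  equilibrium both gains vanish. The Bellman equations for the gains then collapse to
  \<open>p\<^sub>1 - p\<^sub>2 = p\<^sub>3 - p\<^sub>4 = C (1 - p\<^sub>2 + p\<^sub>4)\<close>. On the torus, this leaves two conditions that
  are homogeneous quadratics in \<open>1 - p\<^sub>1\<close> and \<open>1 - p\<^sub>1 + p\<^sub>3\<close>; their quotient is a nontrivial
  quadratic equation for the ratio of these two quantities, and the ratio determines the point. So
  there are in fact at most two equilibria.
\<close>

section \<open>Determinants of 4 by 4 matrices\<close>

lemma vector_4:
  "(vector [x, y, z, w] :: 'a::zero ^ 4) $ 1 = x"
  "(vector [x, y, z, w] :: 'a::zero ^ 4) $ 2 = y"
  "(vector [x, y, z, w] :: 'a::zero ^ 4) $ 3 = z"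
  "(vector [x, y, z, w] :: 'a::zero ^ 4) $ 4 = w"
  unfolding vector_def by simp_all

text \<open>Every permutation is a transposition composed with a permutation fixing one index; three
  such splittings make the sum explicit.\<close>

lemma det_4:
  fixes A :: "'a::comm_ring_1 ^ 4 ^ 4"
  shows "det A =
    A$1$1 * (A$2$2 * (A$3$3 * A$4$4 - A$3$4 * A$4$3)
      - A$2$3 * (A$3$2 * A$4$4 - A$3$4 * A$4$2) + A$2$4 * (A$3$2 * A$4$3 - A$3$3 * A$4$2))
    - A$1$2 * (A$2$1 * (A$3$3 * A$4$4 - A$3$4 * A$4$3)
      - A$2$3 * (A$3$1 * A$4$4 - A$3$4 * A$4$1) + A$2$4 * (A$3$1 * A$4$3 - A$3$3 * A$4$1))
    + A$1$3 * (A$2$1 * (A$3$2 * A$4$4 - A$3$4 * A$4$2)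
      - A$2$2 * (A$3$1 * A$4$4 - A$3$4 * A$4$1) + A$2$4 * (A$3$1 * A$4$2 - A$3$2 * A$4$1))
    - A$1$4 * (A$2$1 * (A$3$2 * A$4$3 - A$3$3 * A$4$2)
      - A$2$2 * (A$3$1 * A$4$3 - A$3$3 * A$4$1) + A$2$3 * (A$3$1 * A$4$2 - A$3$2 * A$4$1))"
proof -
  have f1: "finite {2::4, 3, 4}" "1 \<notin> {2::4, 3, 4}" by auto
  have f2: "finite {3::4, 4}" "2 \<notin> {3::4, 4}" by auto
  have f3: "finite {4::4}" "3 \<notin> {4::4}" by auto
  show ?thesis
    unfolding det_def UNIV_4
    unfolding sum_over_permutations_insert[OF f1]
    unfolding sum_over_permutations_insert[OF f2]
    unfolding sum_over_permutations_insert[OF f3]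
    unfolding permutes_sing
    by (simp add: sign_swap_id permutation_swap_id permutation_compose sign_compose sign_id
        swap_id_eq algebra_simps)
qed

section \<open>Stationary weights, gains and defects\<close>

text \<open>
  For \<^term>\<open>p = q\<close> the game is a single sequence of moves, each drawn from the last two.
  The product of \<open>stationary_norm\<close> and \<open>ergodicity_factor\<close> is minus the denominator of the payoff:
  the transition matrix is the square of the one-move matrix \<open>B\<close>, the first factor comes from
  \<open>B - I\<close> and is the sum of the unnormalised stationary weights
  \<open>p\<^sub>3 p\<^sub>4, p\<^sub>4 (1 - p\<^sub>1), p\<^sub>4 (1 - p\<^sub>1), (1 - p\<^sub>1) (1 - p\<^sub>2)\<close>, the second is \<open>det (B + I) / 2\<close>.
\<close>

definition stationary_norm :: "real ^ 4 \<Rightarrow> real" where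
  "stationary_norm p = p$3 * p$4 + 2 * p$4 * (1 - p$1) + (1 - p$1) * (1 - p$2)"

definition ergodicity_factor :: "real ^ 4 \<Rightarrow> real" where
  "ergodicity_factor p = (1 + p$1) * (1 - p$2) + p$3 * (2 * p$2 - p$4)"

text \<open>\<open>defect_C\<close> and \<open>defect_D\<close> are the residuals of the Bellman
  equations at zero gains.\<close>

definition defect_C :: "real \<Rightarrow> real ^ 4 \<Rightarrow> real" where
  "defect_C C p = p$1 - p$2 - C * (1 - p$2 + p$4)"

definition defect_D :: "real \<Rightarrow> real ^ 4 \<Rightarrow> real" where
  "defect_D C p = p$3 - p$4 - C * (1 - p$2 + p$4)"

text \<open>
  Up to the positive factor \<open>stationary_norm p * ergodicity_factor p\<close>, these are the long-run gains
  from cooperating instead of defecting when the co-player has just cooperated resp. defected.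
\<close>

definition gain_C :: "real \<Rightarrow> real ^ 4 \<Rightarrow> real" where
  "gain_C C p = (1 - (p$2 - p$4) * (1 - p$3) + C * p$4) * defect_C C p
    + ((p$2 - p$4) * (1 - p$1) - C * p$4) * defect_D C p"

definition gain_D :: "real \<Rightarrow> real ^ 4 \<Rightarrow> real" where
  "gain_D C p = (1 - p$1 * (p$1 - p$3) - C * p$3) * defect_D C p
    + p$3 * (p$1 - p$3 + C) * defect_C C p"

lemma deriv_affine_quotient:
  fixes a b c d x :: real
  assumes "c \<noteq> 0"
  shows "deriv (\<lambda>t. (a + b * (t - x)) / (c + d * (t - x))) x = (b * c - a * d) / c\<^sup>2"
proof (rule DERIV_imp_deriv)
  show "((\<lambda>t. (a + b * (t - x)) / (c + d * (t - x))) has_real_derivative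
      (b * c - a * d) / c\<^sup>2) (at x)"
    using assms by (auto intro!: derivative_eq_intros simp: power2_eq_square)
qed

lemma open_cubeD:
  assumes "p \<in> open_cube"
  shows "0 < p$i" "p$i < 1"
  using assms by (auto simp: open_cube_def)

lemma stationary_norm_pos:
  assumes "p \<in> open_cube"
  shows "0 < stationary_norm p"
  using open_cubeD[OF assms] by (auto simp: stationary_norm_def intro!: add_pos_pos mult_pos_pos)

lemma ergodicity_factor_pos:
  assumes "p \<in> open_cube"
  shows "0 < ergodicity_factor p"
proof -
  note p = open_cubeD[OF assms]
  have "p$3 * p$4 < 1"
    using p mult_strict_mono[of "p$3" 1 "p$4" 1] by (simp add: less_imp_le)
  then have "0 < (1 - p$2) * (1 + p$1 - p$3 * p$4)"
    using p[of 1] p[of 2] by (intro mult_pos_pos) auto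
  moreover have "0 < p$2 * (p$3 * (2 - p$4))"
    using p[of 2] p[of 3] p[of 4] by (intro mult_pos_pos) auto
  \<comment> \<open>The factor is affine in \<open>p$2\<close>, hence a convex combination of its
    values at 0 and 1.\<close>
  moreover have "ergodicity_factor p =
      (1 - p$2) * (1 + p$1 - p$3 * p$4) + p$2 * (p$3 * (2 - p$4))"
    by (simp add: ergodicity_factor_def algebra_simps)
  ultimately show ?thesis by simp
qed

text \<open>
  The coefficients of the gains in the next two identities are those of the linear system that
  remains after the co-player's gains are eliminated from the Bellman equations.
\<close>

lemma defect_C_eq:
  "stationary_norm p * ergodicity_factor p * defect_C C p =
    (1 - p$2 + p$4 - p$1 * ((1 - p$2 + p$4) * p$1 + (p$2 - p$4) * p$3) + p$2 * p$3) * gain_C C p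
    + (p$1 * ((1 - p$2 + p$4) * p$2 + (p$2 - p$4) * p$4) - p$2 * p$4
       - (p$2 - p$4) * (1 - p$2 + p$4)) * gain_D C p"
  unfolding stationary_norm_def ergodicity_factor_def gain_C_def gain_D_def defect_C_def defect_D_def
  by algebra

lemma defect_D_eq:
  "stationary_norm p * ergodicity_factor p * defect_D C p =
    p$3 * (p$4 - (1 - p$2 + p$4) * p$1 - (p$2 - p$4) * p$3) * gain_C C p
    + (1 - p$2 + p$4 + p$3 * ((1 - p$2 + p$4) * p$2 + (p$2 - p$4) * p$4) - p$4 * p$4
       - (p$2 - p$4) * (1 - p$2 + p$4)) * gain_D C p"
  unfolding stationary_norm_def ergodicity_factor_def gain_C_def gain_D_def defect_C_def defect_D_def
  by algebra

section \<open>Payoff gradient and equilibrium equations\<close>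

lemmas payoff_det_simps =
  det_4 replace_last_column_def transition_matrix_def mat_def vector_4 donation_payoffs_def

text \<open>Only one matrix row depends on \<open>t\<close>, and affinely, so both determinants are
  affine in \<open>t\<close>; expanding at \<open>p$1\<close> prepares for
  \<open>deriv_affine_quotient\<close>.\<close>

lemma payoff_vary_1:
  "payoff (donation_payoffs C) (\<chi> j. if j = 1 then t else p$j) p =
    (- (ergodicity_factor p * ((1 - C) * p$4 * (1 - p$1 + p$3)))
       + p$4 * ((1 - C) * p$1 * (1 - p$2) + p$3 * (2 * p$2 - p$4 + C * (1 - p$2))) * (t - p$1)) /
    (- (stationary_norm p * ergodicity_factor p)
       + (p$1 * (1 - p$2)\<^sup>2 + 2 * p$1 * p$4 * (1 - p$2) + p$2 * p$3 * (1 - p$2)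
          + p$3 * p$4 * (3 * p$2 - p$4 - 1)) * (t - p$1))"
proof -
  let ?M = "\<lambda>v. replace_last_column (transition_matrix (\<chi> j. if j = 1 then t else p$j) p - mat 1) v"
  have "det (?M (donation_payoffs C)) =
      - (ergodicity_factor p * ((1 - C) * p$4 * (1 - p$1 + p$3)))
      + p$4 * ((1 - C) * p$1 * (1 - p$2) + p$3 * (2 * p$2 - p$4 + C * (1 - p$2))) * (t - p$1)"
    by (simp add: payoff_det_simps ergodicity_factor_def) algebra
  moreover have "det (?M (vector [1, 1, 1, 1])) =
      - (stationary_norm p * ergodicity_factor p)
      + (p$1 * (1 - p$2)\<^sup>2 + 2 * p$1 * p$4 * (1 - p$2) + p$2 * p$3 * (1 - p$2)
         + p$3 * p$4 * (3 * p$2 - p$4 - 1)) * (t - p$1)"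
    by (simp add: payoff_det_simps stationary_norm_def ergodicity_factor_def) algebra
  ultimately show ?thesis by (simp add: payoff_def)
qed

lemma payoff_vary_2:
  "payoff (donation_payoffs C) (\<chi> j. if j = 2 then t else p$j) p =
    (- (ergodicity_factor p * ((1 - C) * p$4 * (1 - p$1 + p$3)))
       + p$4 * (1 - (p$1 - p$3)\<^sup>2 - p$3 - C * p$3 * (p$1 - p$3)) * (t - p$2)) /
    (- (stationary_norm p * ergodicity_factor p)
       + ((1 - (p$1)\<^sup>2) * (1 - p$2 + p$4)
          + p$3 * ((1 - p$1) * (2 * p$2 - 1) + p$4 * (3 * p$1 - p$3 - 2))) * (t - p$2))"
proof -
  let ?M = "\<lambda>v. replace_last_column (transition_matrix (\<chi> j. if j = 2 then t else p$j) p - mat 1) v"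
  have "det (?M (donation_payoffs C)) =
      - (ergodicity_factor p * ((1 - C) * p$4 * (1 - p$1 + p$3)))
      + p$4 * (1 - (p$1 - p$3)\<^sup>2 - p$3 - C * p$3 * (p$1 - p$3)) * (t - p$2)"
    by (simp add: payoff_det_simps ergodicity_factor_def) algebra
  moreover have "det (?M (vector [1, 1, 1, 1])) =
      - (stationary_norm p * ergodicity_factor p)
      + ((1 - (p$1)\<^sup>2) * (1 - p$2 + p$4)
         + p$3 * ((1 - p$1) * (2 * p$2 - 1) + p$4 * (3 * p$1 - p$3 - 2))) * (t - p$2)"
    by (simp add: payoff_det_simps stationary_norm_def ergodicity_factor_def) algebra
  ultimately show ?thesis by (simp add: payoff_def)
qed

text \<open>The factor \<open>p$3 * p$4\<close> is the unnormalised stationary weight of CC, the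
  outcome to which \<open>p$1\<close> responds.\<close>

lemma adaptive_dynamics_1:
  assumes "p \<in> open_cube"
  shows "adaptive_dynamics (donation_payoffs C) p $ 1 =
    p$3 * p$4 * gain_C C p / ((stationary_norm p)\<^sup>2 * ergodicity_factor p)"
proof -
  have pos: "stationary_norm p \<noteq> 0" "ergodicity_factor p \<noteq> 0"
    using stationary_norm_pos[OF assms] ergodicity_factor_pos[OF assms] by auto
  \<comment> \<open>This is the quotient rule's numerator divided by
    \<open>- ergodicity_factor p\<close>.\<close>
  have "(p$4 * ((1 - C) * p$1 * (1 - p$2) + p$3 * (2 * p$2 - p$4 + C * (1 - p$2))))
        * stationary_norm p
      - (1 - C) * p$4 * (1 - p$1 + p$3)
        * (p$1 * (1 - p$2)\<^sup>2 + 2 * p$1 * p$4 * (1 - p$2) + p$2 * p$3 * (1 - p$2)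
          + p$3 * p$4 * (3 * p$2 - p$4 - 1))
      = - (p$3 * p$4 * gain_C C p)"
    unfolding stationary_norm_def gain_C_def defect_C_def defect_D_def by algebra
  with pos show ?thesis
    unfolding adaptive_dynamics_def vec_lambda_beta payoff_vary_1
    by (subst deriv_affine_quotient) (simp, simp add: frac_eq_eq, algebra)
qed

lemma adaptive_dynamics_2:
  assumes "p \<in> open_cube"
  shows "adaptive_dynamics (donation_payoffs C) p $ 2 =
    p$4 * (1 - p$1) * gain_D C p / ((stationary_norm p)\<^sup>2 * ergodicity_factor p)"
proof -
  have pos: "stationary_norm p \<noteq> 0" "ergodicity_factor p \<noteq> 0"
    using stationary_norm_pos[OF assms] ergodicity_factor_pos[OF assms] by auto
  have "(p$4 * (1 - (p$1 - p$3)\<^sup>2 - p$3 - C * p$3 * (p$1 - p$3))) * stationary_norm p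
      - (1 - C) * p$4 * (1 - p$1 + p$3)
        * ((1 - (p$1)\<^sup>2) * (1 - p$2 + p$4)
          + p$3 * ((1 - p$1) * (2 * p$2 - 1) + p$4 * (3 * p$1 - p$3 - 2)))
      = - (p$4 * (1 - p$1) * gain_D C p)"
    unfolding stationary_norm_def gain_D_def defect_C_def defect_D_def by algebra
  with pos show ?thesis
    unfolding adaptive_dynamics_def vec_lambda_beta payoff_vary_2
    by (subst deriv_affine_quotient) (simp, simp add: frac_eq_eq, algebra)
qed

lemma equilibrium_defects:
  assumes "p \<in> open_cube" and "is_equilibrium (donation_payoffs C) p"
  shows "defect_C C p = 0" and "defect_D C p = 0"
proof -
  note pos = open_cubeD[OF assms(1)] stationary_norm_pos[OF assms(1)] ergodicity_factor_pos[OF assms(1)]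
  have "gain_C C p = 0"
    using assms(2) adaptive_dynamics_1[OF assms(1), of C] pos(1)[of 3] pos(1)[of 4] pos(3,4)
    by (auto simp: is_equilibrium_def)
  moreover have "gain_D C p = 0"
    using assms(2) adaptive_dynamics_2[OF assms(1), of C] pos(1)[of 4] pos(2)[of 1] pos(3,4)
    by (auto simp: is_equilibrium_def)
  ultimately show "defect_C C p = 0" "defect_D C p = 0"
    using defect_C_eq[of p C] defect_D_eq[of p C] pos(3,4) by auto
qed

section \<open>Angles on the torus\<close>

lemma sin_cos_inj_on_0_2pi:
  fixes x y :: real
  assumes "sin x = sin y" "cos x = cos y" "x \<in> {0<..<2 * pi}" "y \<in> {0<..<2 * pi}"
  shows "x = y"
proof -
  obtain n :: int where n: "x = y + 2 * pi * n"
    using assms(1,2) sin_cos_eq_iff[of x y] by auto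
  have "\<bar>x - y\<bar> < 2 * pi"
    using assms(3,4) by auto
  then have "2 * pi * \<bar>real_of_int n\<bar> < 2 * pi"
    using n by (simp add: abs_mult)
  then have "\<bar>real_of_int n\<bar> < 1"
    by (metis mult_less_cancel_left_pos mult.right_neutral pi_gt_zero zero_less_mult_iff zero_less_numeral)
  then have "n = 0" by linarith
  with n show ?thesis by simp
qed

lemma torus_point_nth:
  "torus_point C1 C2 \<phi> \<psi> $ 1 = 1 + sqrt C1 * sin \<phi>"
  "torus_point C1 C2 \<phi> \<psi> $ 2 = 1 + sqrt C2 * sin \<psi>"
  "torus_point C1 C2 \<phi> \<psi> $ 3 = sqrt C1 * cos \<phi>"
  "torus_point C1 C2 \<phi> \<psi> $ 4 = sqrt C2 * cos \<psi>"
  by (simp_all add: torus_point_def vector_4)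

lemma torus_point_inj:
  assumes "0 < C1" "0 < C2"
    and range: "\<phi> \<in> {0..2 * pi}" "\<psi> \<in> {0..2 * pi}" "\<phi>' \<in> {0..2 * pi}" "\<psi>' \<in> {0..2 * pi}"
    and cube: "torus_point C1 C2 \<phi> \<psi> \<in> open_cube"
    and eq: "torus_point C1 C2 \<phi> \<psi> = torus_point C1 C2 \<phi>' \<psi>'"
  shows "\<phi> = \<phi>' \<and> \<psi> = \<psi>'"
proof -
  have sc: "sin \<phi> = sin \<phi>'" "cos \<phi> = cos \<phi>'" "sin \<psi> = sin \<psi>'" "cos \<psi> = cos \<psi>'"
    using eq assms(1,2) torus_point_nth[of C1 C2 \<phi> \<psi>] torus_point_nth[of C1 C2 \<phi>' \<psi>'] by auto
  \<comment> \<open>The angles 0 and \<open>2 * pi\<close> give the same point;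
    \<open>p$1 < 1\<close> and \<open>p$2 < 1\<close> rule them out.\<close>
  have "sin \<phi> \<noteq> 0" "sin \<psi> \<noteq> 0"
    using open_cubeD(2)[OF cube, of 1] open_cubeD(2)[OF cube, of 2] by (auto simp: torus_point_nth)
  then have "x \<noteq> 0 \<and> x \<noteq> 2 * pi" if "x \<in> {\<phi>, \<psi>, \<phi>', \<psi>'}" for x
    using that sc by auto
  with range have "x \<in> {0<..<2 * pi}" if "x \<in> {\<phi>, \<psi>, \<phi>', \<psi>'}" for x
    using that by (smt (verit) atLeastAtMost_iff empty_iff greaterThanLessThan_iff insert_iff)
  with sc show ?thesis
    by (blast intro: sin_cos_inj_on_0_2pi)
qed

text \<open>
  At an equilibrium \<open>1 - p\<^sub>1 + p\<^sub>3 = 1 - p\<^sub>2 + p\<^sub>4 = s\<close>. Dividing by this common scale, the point is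
  described by \<open>u = (1 - p\<^sub>1) / s\<close>, since \<open>(1 - p\<^sub>2) / s = u + C\<close>.
\<close>

definition shape :: "real ^ 4 \<Rightarrow> real" where
  "shape p = (1 - p$1) / (1 - p$1 + p$3)"

lemma defects_zero_param:
  assumes "p \<in> open_cube" and "defect_C C p = 0" and "defect_D C p = 0"
  defines "s \<equiv> 1 - p$1 + p$3" and "u \<equiv> shape p"
  shows "0 < s" "p$1 = 1 - u * s" "p$3 = (1 - u) * s"
    "p$2 = 1 - (u + C) * s" "p$4 = (1 - u - C) * s"
proof -
  show s: "0 < s"
    using open_cubeD(2)[OF assms(1), of 1] open_cubeD(1)[OF assms(1), of 3] by (simp add: s_def)
  then have us: "u * s = 1 - p$1"
    by (simp add: u_def shape_def s_def)
  have s': "s = 1 - p$2 + p$4"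
    using assms(2,3) by (simp add: defect_C_def defect_D_def s_def)
  have "p$1 - p$2 = C * s"
    using assms(2) by (simp add: defect_C_def s')
  then show "p$1 = 1 - u * s" "p$3 = (1 - u) * s" "p$2 = 1 - (u + C) * s" "p$4 = (1 - u - C) * s"
    using us s' meta_eq_to_obj_eq[OF s_def] by algebra+
qed

text \<open>Eliminating \<open>s\<close> from the two circle equations leaves this quadratic in
  \<open>u\<close>.\<close>

definition shape_poly :: "real \<Rightarrow> real \<Rightarrow> real \<Rightarrow> real poly" where
  "shape_poly C C1 C2 = [: C2 - C1 * (C\<^sup>2 + (1 - C)\<^sup>2), 2 * C1 * (1 - 2 * C) - 2 * C2, 2 * (C2 - C1) :]"

lemma poly_shape_poly:
  "poly (shape_poly C C1 C2) u = C2 * (u\<^sup>2 + (1 - u)\<^sup>2) - C1 * ((u + C)\<^sup>2 + (1 - u - C)\<^sup>2)"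
  by (simp add: shape_poly_def power2_eq_square algebra_simps)

text \<open>If the leading coefficient vanishes, then \<open>C1 = C2\<close> and the linear one is
  \<open>- 4 * C * C1\<close>.\<close>

lemma shape_poly_nonzero:
  assumes "C \<noteq> 0" "C1 \<noteq> 0"
  shows "shape_poly C C1 C2 \<noteq> 0"
  using assms by (auto simp: shape_poly_def algebra_simps)

theorem corollary3p9:
  fixes C C1 C2 :: real
  assumes "0 < C" and "C < 1"
    and "0 < C1" and "C1 \<le> 2"
    and "0 < C2" and "C2 \<le> 2"
  defines "E \<equiv> {(\<phi>, \<psi>). \<phi> \<in> {0..2 * pi} \<and> \<psi> \<in> {0..2 * pi}
      \<and> torus_point C1 C2 \<phi> \<psi> \<in> open_cube
      \<and> is_equilibrium (donation_payoffs C) (torus_point C1 C2 \<phi> \<psi>)}"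
  shows "finite E \<and> card E \<le> 4"
proof -
  define pt where "pt = (\<lambda>(\<phi>, \<psi>). torus_point C1 C2 \<phi> \<psi>)"
  define s where "s x = 1 - pt x $ 1 + pt x $ 3" for x
  let ?u = "\<lambda>x. shape (pt x)"
  let ?R = "{u. poly (shape_poly C C1 C2) u = 0}"
  have cube: "pt x \<in> open_cube" if "x \<in> E" for x
    using that by (auto simp: E_def pt_def)
  have "defect_C C (pt x) = 0" "defect_D C (pt x) = 0" if "x \<in> E" for x
    using that equilibrium_defects by (auto simp: E_def pt_def)
  note param = defects_zero_param[OF cube this, folded s_def]
  have on_circles: "(1 - pt x $ 1)\<^sup>2 + (pt x $ 3)\<^sup>2 = C1" "(1 - pt x $ 2)\<^sup>2 + (pt x $ 4)\<^sup>2 = C2" for x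
    using assms(3,5)
    by (auto simp: pt_def torus_point_nth power_mult_distrib simp flip: distrib_left split: prod.split)
  have circ: "(s x)\<^sup>2 * ((?u x)\<^sup>2 + (1 - ?u x)\<^sup>2) = C1"
      "(s x)\<^sup>2 * ((?u x + C)\<^sup>2 + (1 - ?u x - C)\<^sup>2) = C2" if "x \<in> E" for x
    using on_circles[of x] unfolding param(2-5)[OF that that that]
    by (simp_all add: power_mult_distrib mult.commute flip: distrib_left distrib_right)
  have sub: "?u ` E \<subseteq> ?R"
  proof (rule image_subsetI)
    fix x
    assume x: "x \<in> E"
    have "(s x)\<^sup>2 * poly (shape_poly C C1 C2) (?u x) =
        C2 * ((s x)\<^sup>2 * ((?u x)\<^sup>2 + (1 - ?u x)\<^sup>2))
        - C1 * ((s x)\<^sup>2 * ((?u x + C)\<^sup>2 + (1 - ?u x - C)\<^sup>2))"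
      unfolding poly_shape_poly by algebra
    also have "\<dots> = 0"
      unfolding circ[OF x] by simp
    finally show "?u x \<in> ?R"
      using param(1)[OF x x x] by simp
  qed
  have inj: "inj_on ?u E"
  proof
    fix x y
    assume xy: "x \<in> E" "y \<in> E" and u: "?u x = ?u y"
    \<comment> \<open>The first circle equation determines \<open>(s x)\<^sup>2\<close> from the
      shape: its other factor is nonzero since \<open>C1 > 0\<close>.\<close>
    have "(s x)\<^sup>2 = (s y)\<^sup>2"
      using circ(1)[OF xy(1)] circ(1)[OF xy(2)] assms(3) unfolding u
      by (metis mult_right_cancel mult_zero_right less_irrefl)
    then have "s x = s y"
      using param(1)[OF xy(1) xy(1) xy(1)] param(1)[OF xy(2) xy(2) xy(2)] by simp
    then have "pt x = pt y"
      using param(2-5)[OF xy(1) xy(1) xy(1)] param(2-5)[OF xy(2) xy(2) xy(2)] u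
      by (simp add: vec_eq_iff forall_4)
    then show "x = y"
      using torus_point_inj[of C1 C2 "fst x" "snd x" "fst y" "snd y"] xy assms(3,5)
      by (auto simp: E_def pt_def)
  qed
  have nz: "shape_poly C C1 C2 \<noteq> 0"
    using assms(1,3) by (intro shape_poly_nonzero) auto
  then have fin: "finite ?R"
    by (rule poly_roots_finite)
  have "card E = card (?u ` E)"
    using inj by (simp add: card_image)
  also have "\<dots> \<le> card ?R"
    using sub fin by (rule card_mono[rotated])
  also have "\<dots> \<le> degree (shape_poly C C1 C2)"
    using nz by (rule card_poly_roots_bound)
  also have "\<dots> \<le> 4"
    by (simp add: shape_poly_def)
  finally show ?thesis
    using finite_imageD[OF finite_subset[OF sub fin] inj] by simp
qed

end
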